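(* The collection of all abstract factorials forms a commutative semigroup under ordinary (pointwise) multiplication of functions $\mathbb{N}\to\mathbb{Z}^+$.
   Context: $\mathbb{N}=\{0,1,2,\dots\}$ and $\mathbb{Z}^+=\{1,2,3,\dots\}$. An abstract factorial is a function $!_{a}:\mathbb{N}\to\mathbb{Z}^+$, $n\mapsto n!_{a}$, such that: (1) $0!_{a}=1$; (2) for all integers $0\le k\le n$, the generalized binomial coefficient $\binom{n}{k}_{a}:=\frac{n!_{a}}{k!_{a}\,(n-k)!_{a}}$ is a positive integer; (3) for every positive integer $n$, the ordinary factorial $n!$ divides $n!_{a}$. *)

theory Defs
  imports Complex_Main
begin

definition gen_binomial :: "(nat \<Rightarrow> nat) \<Rightarrow> nat \<Rightarrow> nat \<Rightarrow> rat" where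
  "gen_binomial f n k = of_nat (f n) / (of_nat (f k) * of_nat (f (n - k)))"

(* A function into the positive integers is encoded as an everywhere positive f :: nat => nat. *)
definition abstract_factorial :: "(nat \<Rightarrow> nat) \<Rightarrow> bool" where
  "abstract_factorial f \<longleftrightarrow>
     (\<forall>n. 0 < f n) \<and>
     f 0 = 1 \<and>
     (\<forall>n k. k \<le> n \<longrightarrow> gen_binomial f n k \<in> \<int> \<and> 0 < gen_binomial f n k) \<and>
     (\<forall>n>0. fact n dvd f n)"

definition pointwise_mult :: "(nat \<Rightarrow> nat) \<Rightarrow> (nat \<Rightarrow> nat) \<Rightarrow> (nat \<Rightarrow> nat)" where
  "pointwise_mult f g = (\<lambda>n. f n * g n)"

(* The library locale abel_semigroup has a whole type as its carrier; this one has a set. *)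
locale comm_semigroup_on =
  fixes S :: "'a set" and mult :: "'a \<Rightarrow> 'a \<Rightarrow> 'a"
  assumes nonempty: "S \<noteq> {}"
    and closed: "\<lbrakk>x \<in> S; y \<in> S\<rbrakk> \<Longrightarrow> mult x y \<in> S"
    and assoc: "\<lbrakk>x \<in> S; y \<in> S; z \<in> S\<rbrakk> \<Longrightarrow> mult (mult x y) z = mult x (mult y z)"
    and commute: "\<lbrakk>x \<in> S; y \<in> S\<rbrakk> \<Longrightarrow> mult x y = mult y x"

end

theory Submission
  imports Defs
begin

text \<open>Each axiom survives products: generalized binomials are multiplicative in the factorial
  (\<open>gen_binomial_pointwise_mult\<close>), so being positive integers passes to the product,
  and a multiple of \<open>f n\<close> is still divisible by \<open>fact n\<close>. The semigroup
  laws come from \<open>nat\<close>.\<close>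

lemma gen_binomial_fact:
  assumes "k \<le> n"
  shows "gen_binomial fact n k = of_nat (n choose k)"
  using binomial_fact[OF assms, where 'a = rat]
  by (simp add: gen_binomial_def)

text \<open>Witness for nonemptiness: its generalized binomials are the usual ones, positive
  integers for \<open>k \<le> n\<close>.\<close>

lemma abstract_factorial_fact: "abstract_factorial fact"
  by (simp add: abstract_factorial_def gen_binomial_fact)

lemma gen_binomial_pointwise_mult:
  "gen_binomial (pointwise_mult f g) n k = gen_binomial f n k * gen_binomial g n k"
  by (simp add: gen_binomial_def pointwise_mult_def)

lemma abstract_factorial_pointwise_mult:
  assumes "abstract_factorial f" "abstract_factorial g"
  shows "abstract_factorial (pointwise_mult f g)"
  using assms unfolding abstract_factorial_def gen_binomial_pointwise_mult
  by (simp add: pointwise_mult_def)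

theorem proposition3:
  shows "comm_semigroup_on {f. abstract_factorial f} pointwise_mult"
proof
  show "{f. abstract_factorial f} \<noteq> {}"
    using abstract_factorial_fact by blast
next
  fix f g
  assume "f \<in> {f. abstract_factorial f}" "g \<in> {f. abstract_factorial f}"
  then show "pointwise_mult f g \<in> {f. abstract_factorial f}"
    by (simp add: abstract_factorial_pointwise_mult)
\<comment> \<open>Associativity and commutativity remain; both hold value by value in
  \<open>nat\<close>.\<close>
qed (simp_all add: pointwise_mult_def mult_ac)

end
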